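(* Let $n\ge 1$ and let $p,q\in\{0,1\}^n$ be binary strings of the same length $n$. Then the mischief between $p$ and $q$ is nonnegative: $M(p,q)\ge 0$.
   Context: Write $p=p_0p_1\cdots p_{n-1}$; indices of a length-$n$ binary string are taken modulo $n$ (any integer congruent to $i$ mod $n$ may replace $i$). For $b\in\{0,1\}$ put $\overline b=1-b$. Sectors. A $b$-sector of $p$ is an inclusion-maximal integer interval $[x,y]=\{x,\dots,y\}$ such that $p_{y-1}=p_y=b$ and, for every $i\in[x,y]$, $p_{i-1}=b$ or $p_i=b$. (So $b$-sectors end with two consecutive $b$'s and extend back as far as possible.) If cyclically $p$ contains two consecutive $b$'s but no two consecutive $\overline b$'s, all indices lie in one $b$-sector. If $p$ is always alternating, i.e. cyclically contains neither two consecutive 0s nor two consecutive 1s, then by convention all indices lie in a single 0-sector. Every index lies in exactly one type of sector; equivalently, unless $p$ is always alternating, $i$ is in a $b$-sector where $b=p_j$ for the smallest $j\ge i$ with $p_{j-1}=p_j$. Define $$s_i(p)=\begin{cases}-1&\text{if } i \text{ is in a 0-sector of } p\\ 1&\text{if } i\text{ is in a 1-sector of }p,\end{cases}$$ $$\delta_i(p)=\begin{cases}0&\text{if } i \text{ and } i+1 \text{ are both in } b\text{-sectors of } p \text{ for the same } b\\ 1&\text{if } i \text{ is in a } b\text{-sector and } i+1 \text{ is in a } \overline b\text{-sector of }p,\end{cases}$$ $$M_i(p,q)=s_i(p)(p_i-q_{i-1})+s_i(q)(q_i-p_{i-1})-\delta_i(p)-\delta_i(q),$$ and define the mischief between $p$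 and $q$ to be $$M(p,q)=\sum_{i=0}^{n-1}M_i(p,q).$$ *)

theory Defs
  imports Main
begin

text \<open>Binary strings are nonempty lists of type \<open>bool list\<close>, with \<open>False\<close> for the digit 0 and
  \<open>True\<close> for the digit 1, so that negation is the bar operation. All indices are integers and are
  read modulo the length of the string.\<close>

definition dig :: "bool list \<Rightarrow> int \<Rightarrow> bool" where
  "dig p i = p ! nat (i mod int (length p))"

definition has_double :: "bool list \<Rightarrow> bool \<Rightarrow> bool" where
  "has_double p b \<longleftrightarrow> (\<exists>i. dig p (i - 1) = b \<and> dig p i = b)"

definition sector_candidate :: "bool list \<Rightarrow> bool \<Rightarrow> int \<Rightarrow> int \<Rightarrow> bool" where
  "sector_candidate p b x y \<longleftrightarrow>
     x \<le> y \<and> dig p (y - 1) = b \<and> dig p y = b \<and>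
     (\<forall>i\<in>{x..y}. dig p (i - 1) = b \<or> dig p i = b)"

definition sector :: "bool list \<Rightarrow> bool \<Rightarrow> int \<Rightarrow> int \<Rightarrow> bool" where
  "sector p b x y \<longleftrightarrow>
     sector_candidate p b x y \<and>
     (\<forall>x' y'. sector_candidate p b x' y' \<and> {x..y} \<subseteq> {x'..y'} \<longrightarrow> {x'..y'} = {x..y})"

text \<open>In the situations of the second and third disjunct no inclusion-maximal interval exists
  (there are no candidates, or each candidate can be enlarged); these two disjuncts are the
  conventions for a string with two consecutive \<open>b\<close>'s but no two consecutive \<open>\<not> b\<close>'s, and for an
  always alternating string.\<close>

definition in_sector :: "bool list \<Rightarrow> bool \<Rightarrow> int \<Rightarrow> bool" where
  "in_sector p b i \<longleftrightarrow>
     (\<exists>x y. sector p b x y \<and> i \<in> {x..y}) \<or>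
     (has_double p b \<and> \<not> has_double p (\<not> b)) \<or>
     (b = False \<and> \<not> has_double p False \<and> \<not> has_double p True)"

text \<open>By \<open>in_sector_unique\<close> below, every index is in exactly one type of sector, so the \<open>else\<close>
  branches of the next two definitions mean that \<open>i\<close> is in a 1-sector, respectively that \<open>i\<close> and
  \<open>i + 1\<close> are in sectors of different types.\<close>

definition sector_sign :: "bool list \<Rightarrow> int \<Rightarrow> int" where
  "sector_sign p i = (if in_sector p False i then -1 else 1)"

definition sector_switch :: "bool list \<Rightarrow> int \<Rightarrow> int" where
  "sector_switch p i = (if \<exists>b. in_sector p b i \<and> in_sector p b (i + 1) then 0 else 1)"

definition mischief_at :: "bool list \<Rightarrow> bool list \<Rightarrow> int \<Rightarrow> int" where
  "mischief_at p q i =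
     sector_sign p i * (of_bool (dig p i) - of_bool (dig q (i - 1)))
     + sector_sign q i * (of_bool (dig q i) - of_bool (dig p (i - 1)))
     - sector_switch p i - sector_switch q i"

text \<open>Used for strings of equal length only.\<close>

definition mischief :: "bool list \<Rightarrow> bool list \<Rightarrow> int" where
  "mischief p q = (\<Sum>i<length p. mischief_at p q (int i))"

lemma dig_shift: "dig p (i + k * int (length p)) = dig p i"
  by (simp add: dig_def)

lemma double_shift:
  assumes "dig p (i - 1) = b" "dig p i = b"
  shows "dig p (i + k * int (length p) - 1) = b \<and> dig p (i + k * int (length p)) = b"
  using assms dig_shift[of p "i - 1" k] dig_shift[of p i k] by (simp add: algebra_simps)

lemma double_above:
  assumes "p \<noteq> []" "has_double p b"
  obtains j where "j \<ge> i" "dig p (j - 1) = b" "dig p j = b"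
proof -
  from assms obtain k where k: "dig p (k - 1) = b" "dig p k = b" by (auto simp: has_double_def)
  define d where "d = \<bar>i - k\<bar>"
  have d: "d \<ge> i - k" "d \<ge> k - i" "d \<ge> 0" by (simp_all add: d_def)
  have "d * 1 \<le> d * int (length p)"
    using assms(1) d(3) by (intro mult_left_mono) (simp_all add: Suc_le_eq)
  then have "k + d * int (length p) \<ge> i" using d by linarith
  with double_shift[OF k] that show thesis by blast
qed

lemma double_below:
  assumes "p \<noteq> []" "has_double p b"
  obtains j where "j \<le> i" "dig p (j - 1) = b" "dig p j = b"
proof -
  from assms obtain k where k: "dig p (k - 1) = b" "dig p k = b" by (auto simp: has_double_def)
  define d where "d = \<bar>i - k\<bar>"
  have d: "d \<ge> i - k" "d \<ge> k - i" "d \<ge> 0" by (simp_all add: d_def)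
  have "d * 1 \<le> d * int (length p)"
    using assms(1) d(3) by (intro mult_left_mono) (simp_all add: Suc_le_eq)
  then have "k + (- d) * int (length p) \<le> i" unfolding mult_minus_left using d by linarith
  with double_shift[OF k] that show thesis by blast
qed

lemma in_sector_intro:
  assumes "p \<noteq> []" "i \<le> j" "dig p (j - 1) = b" "dig p j = b"
    and alt: "\<And>k. i \<le> k \<Longrightarrow> k < j \<Longrightarrow> dig p (k - 1) \<noteq> dig p k"
  shows "in_sector p b i"
proof (cases "has_double p (\<not> b)")
  case False
  then show ?thesis using assms(3,4) by (auto simp: in_sector_def has_double_def)
next
  case True
  obtain L where L: "L \<le> i" "dig p (L - 1) = (\<not> b)" "dig p L = (\<not> b)"
    using double_below[OF assms(1) True] .
  obtain U where U: "U \<ge> j" "dig p (U - 1) = (\<not> b)" "dig p U = (\<not> b)"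
    using double_above[OF assms(1) True] .
  define C where "C = (\<lambda>(x, y). sector_candidate p b x y \<and> x \<le> i \<and> j \<le> y)"
  have cand: "dig p (k - 1) = b \<or> dig p k = b" if "k \<in> {i..j}" for k
    using alt[of k] that assms(3,4) by (cases "k = j") auto
  have C0: "C (i, j)" using assms(2,3,4) cand by (simp add: C_def sector_candidate_def)
  have bound: "L < x \<and> y < U" if "C (x, y)" for x y
  proof -
    have *: "\<And>k. x \<le> k \<Longrightarrow> k \<le> y \<Longrightarrow> dig p (k - 1) = b \<or> dig p k = b"
      and xy: "x \<le> i" "j \<le> y" using that by (auto simp: C_def sector_candidate_def)
    show ?thesis using *[of L] *[of U] L U xy assms(2) by force
  qed
  have "\<exists>z. C z \<and> (\<forall>w. C w \<longrightarrow> nat (snd w - fst w) \<le> nat (snd z - fst z))"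
  proof (rule ex_has_greatest_nat[where b = "Suc (nat (U - L))"])
    show "C (i, j)" by (rule C0)
    show "\<forall>w. C w \<longrightarrow> nat (snd w - fst w) < Suc (nat (U - L))"
    proof (intro allI impI)
      fix w assume "C w"
      then have "C (fst w, snd w)" by simp
      from bound[OF this] show "nat (snd w - fst w) < Suc (nat (U - L))" by linarith
    qed
  qed
  then obtain x y where xy: "C (x, y)"
    and mx: "\<And>x' y'. C (x', y') \<Longrightarrow> nat (y' - x') \<le> nat (y - x)" by auto
  have "sector p b x y" unfolding sector_def
  proof (intro conjI allI impI)
    show "sector_candidate p b x y" using xy by (simp add: C_def)
    fix x' y' assume a: "sector_candidate p b x' y' \<and> {x..y} \<subseteq> {x'..y'}"
    have le: "x \<le> i" "j \<le> y" using xy by (auto simp: C_def)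
    then have sub: "x' \<le> x" "y \<le> y'" using a assms(2) by auto
    then have "C (x', y')" using a le by (simp add: C_def)
    from mx[OF this] sub le assms(2) have "x' = x \<and> y' = y" by linarith
    then show "{x'..y'} = {x..y}" by simp
  qed
  moreover have "i \<in> {x..y}" using xy assms(2) by (auto simp: C_def)
  ultimately show ?thesis unfolding in_sector_def by blast
qed

lemma in_sector_alternating:
  assumes "\<not> has_double p False" "\<not> has_double p True"
  shows "in_sector p b i \<longleftrightarrow> b = False"
proof -
  have "\<not> has_double p b" using assms by (cases b) auto
  then show ?thesis using assms
    by (auto simp: in_sector_def sector_def sector_candidate_def has_double_def)
qed

lemma in_sector_disjoint:
  assumes "in_sector p b i"
  shows "\<not> in_sector p (\<not> b) i"
proof (cases "has_double p True \<or> has_double p False")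
  case False
  then show ?thesis using assms by (simp add: in_sector_alternating)
next
  case True
  have dbl: "has_double p c" if "sector p c x y" for c x y
    using that by (auto simp: sector_def sector_candidate_def has_double_def)
  have disj: False
    if "sector p c x y" "sector p (\<not> c) x' y'" "i \<in> {x..y}" "i \<in> {x'..y'}" "y \<le> y'" for c x y x' y'
  proof -
    have "dig p (y - 1) = c" "dig p y = c" using that by (auto simp: sector_def sector_candidate_def)
    moreover have "y \<in> {x'..y'}" using that by auto
    ultimately show False using that(2) unfolding sector_def sector_candidate_def by blast
  qed
  show ?thesis
  proof
    assume n: "in_sector p (\<not> b) i"
    have na: "\<not> (c = False \<and> \<not> has_double p False \<and> \<not> has_double p True)" for c using True by blast
    have nn: "(\<not> \<not> b) = b" by simp
    from assms n have cs: "(\<exists>x y. sector p b x y \<and> i \<in> {x..y}) \<or> has_double p b \<and> \<not> has_double p (\<not> b)"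
      "(\<exists>x y. sector p (\<not> b) x y \<and> i \<in> {x..y}) \<or> has_double p (\<not> b) \<and> \<not> has_double p b"
      unfolding in_sector_def nn using na by (blast, blast)
    then have "\<exists>x y. sector p b x y \<and> i \<in> {x..y}" "\<exists>x y. sector p (\<not> b) x y \<and> i \<in> {x..y}"
      using dbl[of b] dbl[of "\<not> b"] by (blast, blast)
    then obtain x y x' y' where
      *: "sector p b x y" "i \<in> {x..y}" "sector p (\<not> b) x' y'" "i \<in> {x'..y'}" by blast
    show False
    proof (cases "y \<le> y'")
      case True then show ?thesis using disj[of b x y x' y'] * by blast
    next
      case False then show ?thesis using disj[of "\<not> b" x' y' x y] * by simp
    qed
  qed
qed

lemma in_sector_unique:
  assumes "p \<noteq> []"
  shows "\<exists>!b. in_sector p b i"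
proof -
  have "\<exists>b. in_sector p b i"
  proof (cases "\<exists>c. has_double p c")
    case False
    then show ?thesis by (auto simp: in_sector_alternating)
  next
    case True
    then obtain c j0 where j0: "j0 \<ge> i" "dig p (j0 - 1) = c" "dig p j0 = c"
      using double_above[OF assms] by metis
    define P where "P = (\<lambda>m::nat. dig p (i + int m - 1) = dig p (i + int m))"
    have "P (nat (j0 - i))" using j0 by (simp add: P_def)
    then have P: "P (Least P)" by (rule LeastI)
    have "in_sector p (dig p (i + int (Least P))) i"
    proof (rule in_sector_intro[OF assms, where j = "i + int (Least P)"])
      fix k assume k: "i \<le> k" "k < i + int (Least P)"
      then have "nat (k - i) < Least P" by linarith
      then have "\<not> P (nat (k - i))" by (rule not_less_Least)
      with k show "dig p (k - 1) \<noteq> dig p k" by (simp add: P_def)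
    qed (use P in \<open>auto simp: P_def\<close>)
    then show ?thesis by blast
  qed
  then obtain b where b: "in_sector p b i" ..
  then have "c = b" if "in_sector p c i" for c
    using that in_sector_disjoint[OF b] by (cases b; cases c) auto
  with b show ?thesis by blast
qed

end

theory Submission
  imports Defs
begin

text \<open>Write \<open>P\<close>, \<open>Q\<close> for the strings with digits turned into signs \<open>\<plusminus>1\<close> and \<open>s\<close>, \<open>t\<close> for their
  sector signs. Then \<open>s i = P i\<close> if \<open>P (i - 1) = P i\<close> and \<open>s i = s (i + 1)\<close> otherwise, so reading
  backwards the tuple \<open>(s i, t i, P (i - 1), Q (i - 1))\<close> is determined by its successor and the two
  new digits. Over this finite automaton the quantity \<open>\<bar>s i + t i + P (i - 1) + Q (i - 1)\<bar>\<close> is a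
  potential: its increment from \<open>i\<close> to \<open>i + 1\<close> is at most twice the mischief at \<open>i\<close>. Since it is
  periodic, the increments cancel over a full period.\<close>

lemma sector_candidate_shift:
  assumes "sector_candidate p b x y"
  shows "sector_candidate p b (x + k * int (length p)) (y + k * int (length p))"
  unfolding sector_candidate_def
proof (intro conjI ballI)
  let ?m = "k * int (length p)"
  have c: "x \<le> y" "dig p (y - 1) = b" "dig p y = b"
    "\<And>i. x \<le> i \<Longrightarrow> i \<le> y \<Longrightarrow> dig p (i - 1) = b \<or> dig p i = b"
    using assms by (simp_all add: sector_candidate_def)
  have sh: "dig p (i + ?m - 1) = dig p (i - 1)" for i
    using dig_shift[of p "i - 1" k] by (simp add: algebra_simps)
  show "x + ?m \<le> y + ?m" using c(1) by simp
  show "dig p (y + ?m - 1) = b" using c(2) by (simp only: sh)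
  show "dig p (y + ?m) = b" using c(3) by (simp only: dig_shift)
  fix j assume "j \<in> {x + ?m..y + ?m}"
  then have "x \<le> j - ?m" "j - ?m \<le> y" by simp_all
  then have "dig p (j - ?m - 1) = b \<or> dig p (j - ?m) = b" by (rule c(4))
  then show "dig p (j - 1) = b \<or> dig p j = b"
    using sh[of "j - ?m"] dig_shift[of p "j - ?m" k] by simp
qed

lemma sector_shift:
  assumes "sector p b x y"
  shows "sector p b (x + k * int (length p)) (y + k * int (length p))"
  unfolding sector_def
proof (intro conjI allI impI)
  let ?m = "k * int (length p)"
  have xy: "x \<le> y" using assms by (simp add: sector_def sector_candidate_def)
  show "sector_candidate p b (x + ?m) (y + ?m)"
    using assms by (simp add: sector_def sector_candidate_shift)
  fix x' y'
  assume a: "sector_candidate p b x' y' \<and> {x + ?m..y + ?m} \<subseteq> {x'..y'}"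
  have "sector_candidate p b (x' - ?m) (y' - ?m)"
    using a sector_candidate_shift[of p b x' y' "- k"] by simp
  moreover have "{x..y} \<subseteq> {x' - ?m..y' - ?m}" using a xy by auto
  ultimately have "{x' - ?m..y' - ?m} = {x..y}" using assms unfolding sector_def by blast
  then show "{x'..y'} = {x + ?m..y + ?m}" using xy by (auto simp: Icc_eq_Icc)
qed

text \<open>Only membership through an actual sector needs translating, as the two conventions in
  \<open>in_sector\<close> do not mention the index. Shifting by \<open>- k\<close> gives the
  converse.\<close>

lemma in_sector_shift: "in_sector p b (i + k * int (length p)) \<longleftrightarrow> in_sector p b i"
proof -
  have *: "in_sector p b (i + k * int (length p))" if "in_sector p b i" for i k
  proof -
    have "\<exists>x' y'. sector p b x' y' \<and> i + k * int (length p) \<in> {x'..y'}"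
      if "sector p b x y" "i \<in> {x..y}" for x y
      using sector_shift[OF that(1), of k] that(2) by fastforce
    with that show ?thesis unfolding in_sector_def by blast
  qed
  show ?thesis using *[of i k] *[of "i + k * int (length p)" "- k"] by auto
qed

text \<open>The interval from \<open>i\<close> to \<open>i\<close> is already a candidate for the
  repeated digit; uniqueness excludes the other type.\<close>

lemma in_sector_double:
  assumes "p \<noteq> []" "dig p (i - 1) = dig p i"
  shows "in_sector p b i \<longleftrightarrow> b = dig p i"
  using in_sector_intro[of p i i "dig p i"] in_sector_unique[of p i] assms by auto

lemma in_sector_step:
  assumes "p \<noteq> []" "dig p (i - 1) \<noteq> dig p i"
  shows "in_sector p b i \<longleftrightarrow> in_sector p b (i + 1)"
proof -
  have *: "in_sector p c i" if "in_sector p c (i + 1)" for c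
  proof -
    have "i \<in> {x..y}" if s: "sector p c x y" "i + 1 \<in> {x..y}" for x y
    proof (rule ccontr)
      assume "i \<notin> {x..y}"
      with s(2) have x: "x = i + 1" "i < y" by auto
      \<comment> \<open>The digits at \<open>i - 1\<close> and \<open>i\<close> differ, so one of
        them is \<open>c\<close>. Hence adjoining \<open>i\<close> keeps a candidate, against
        maximality.\<close>
      have "{i..y} = insert i {x..y}" using x by auto
      then have "sector_candidate p c i y"
        using s(1) x assms(2) by (auto simp: sector_def sector_candidate_def)
      then have "{i..y} = {x..y}" using s(1) x unfolding sector_def by fastforce
      then show False using x by auto
    qed
    with that show ?thesis unfolding in_sector_def by blast
  qed
  \<comment> \<open>Some type \<open>c\<close> occurs at \<open>i + 1\<close>; it passes back to
    \<open>i\<close>, where uniqueness forces \<open>c = b\<close>.\<close>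
  moreover have "in_sector p b (i + 1)" if "in_sector p b i"
  proof -
    obtain c where c: "in_sector p c (i + 1)"
      using in_sector_unique[OF assms(1), of "i + 1"] by blast
    have "c = b" using *[OF c] that in_sector_unique[OF assms(1), of i] by blast
    with c show ?thesis by simp
  qed
  ultimately show ?thesis by blast
qed

lemma sector_sign_rec:
  assumes "p \<noteq> []"
  shows "sector_sign p i =
    (if dig p (i - 1) = dig p i then 2 * of_bool (dig p i) - 1 else sector_sign p (i + 1))"
  using in_sector_double[OF assms] in_sector_step[OF assms] by (auto simp: sector_sign_def)

lemma sector_switch_conv_sign:
  assumes "p \<noteq> []"
  shows "sector_switch p i = of_bool (sector_sign p i \<noteq> sector_sign p (i + 1))"
proof -
  have "in_sector p True j \<longleftrightarrow> \<not> in_sector p False j" for j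
    using in_sector_unique[OF assms, of j] by (metis (full_types))
  then show ?thesis by (auto simp: sector_switch_def sector_sign_def ex_bool_eq)
qed

definition potential :: "bool list \<Rightarrow> bool list \<Rightarrow> int \<Rightarrow> int" where
  "potential p q i = \<bar>sector_sign p i + sector_sign q i
     + (2 * of_bool (dig p (i - 1)) - 1) + (2 * of_bool (dig q (i - 1)) - 1)\<bar>"

text \<open>Equal lengths give both strings, and hence both sector signs, a common period.\<close>

lemma potential_shift:
  assumes "length p = length q"
  shows "potential p q (i + int (length p)) = potential p q i"
  using in_sector_shift[of p False i 1] in_sector_shift[of q False i 1]
    dig_shift[of p "i - 1" 1] dig_shift[of q "i - 1" 1] assms
  by (simp add: potential_def sector_sign_def algebra_simps)

lemma potential_step:
  assumes "p \<noteq> []" "q \<noteq> []"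
  shows "potential p q (i + 1) - potential p q i \<le> 2 * mischief_at p q i"
proof -
  have sign: "sector_sign r j \<in> {-1, 1}" for r j
    by (simp add: sector_sign_def)
  have pred: "i + 1 - 1 = i" by simp
  note unfold = potential_def mischief_at_def sector_switch_conv_sign[OF assms(1)]
    sector_switch_conv_sign[OF assms(2)] sector_sign_rec[OF assms(1), of i]
    sector_sign_rec[OF assms(2), of i] pred
  \<comment> \<open>The sign recursion runs backwards, so the split is on the signs at
    \<open>i + 1\<close>. Together with the four digits at \<open>i - 1\<close> and \<open>i\<close>
    they determine both sides, leaving 64 numerical inequalities.\<close>
  consider "sector_sign p (i + 1) = -1" "sector_sign q (i + 1) = -1"
    | "sector_sign p (i + 1) = -1" "sector_sign q (i + 1) = 1"
    | "sector_sign p (i + 1) = 1" "sector_sign q (i + 1) = -1"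
    | "sector_sign p (i + 1) = 1" "sector_sign q (i + 1) = 1"
    using sign[of p "i + 1"] sign[of q "i + 1"] by blast
  then show ?thesis
    by cases (cases "dig p i"; cases "dig p (i - 1)"; cases "dig q i"; cases "dig q (i - 1)";
        simp only: unfold; simp)+
qed

theorem theorem5p1:
  fixes n :: nat and p q :: "bool list"
  assumes "n \<ge> 1" and "length p = n" and "length q = n"
  shows "mischief p q \<ge> 0"
proof -
  have ne: "p \<noteq> []" "q \<noteq> []" using assms by auto
  have step: "potential p q (int (Suc i)) - potential p q (int i) \<le> 2 * mischief_at p q (int i)" for i
    using potential_step[OF ne, of "int i"] by (simp add: add.commute)
  have "0 = potential p q (int n) - potential p q 0"
    using potential_shift[of p q 0] assms by simp
  also have "\<dots> = (\<Sum>i<n. potential p q (int (Suc i)) - potential p q (int i))"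
    by (subst sum_lessThan_telescope) simp
  also have "\<dots> \<le> (\<Sum>i<n. 2 * mischief_at p q (int i))"
    by (intro sum_mono step)
  also have "\<dots> = 2 * mischief p q"
    by (simp add: mischief_def assms(2) sum_distrib_left)
  finally show ?thesis by simp
qed

end
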